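(* Let $X$ be a (real or complex) Banach space, let $X_1,\dots,X_n$ be complemented subspaces of $X$, and let $P_1,\dots,P_n$ be (continuous linear) projections onto $X_1,\dots,X_n$, respectively. Suppose nonnegative numbers $\varepsilon_{ij}$ ($i\neq j$, $i,j\in\{1,\dots,n\}$) satisfy $\|P_i x\|\leqslant \varepsilon_{ij}\|x\|$ for all $x\in X_j$ and every $i\neq j$. Let $E=(e_{ij})$ be the $n\times n$ matrix with $e_{ii}=0$ and $e_{ij}=\varepsilon_{ij}$ for $i\neq j$, and set $A=P_1+\dots+P_n$. Let $P$ denote the projection onto $X_1+\dots+X_n$ along $\ker(P_1)\cap\dots\cap\ker(P_n)$. (1) Suppose a vector $w=(w_1,\dots,w_n)^t\in\mathbb{R}^n$ with positive coordinates and a number $\alpha\in[0,1)$ satisfy $Ew\leqslant\alpha w$. Then $$\|I-(I-A)^N-P\|\leqslant(w_1+\dots+w_n)\max\{(1/w_1)\|P_1\|,\dots,(1/w_n)\|P_n\|\}\frac{\alpha^N}{1-\alpha}$$ for each $N\geqslant 1$. (2) Suppose a vector $w=(w_1,\dots,w_n)^t\in\mathbb{R}^n$ with positive coordinates and a number $\alpha\in[0,1)$ satisfy $E^t w\leqslant\alpha w$. Then $$\|I-(I-A)^N-P\|\leqslant(w_1\|P_1\|+\dots+w_n\|P_n\|)\max\{1/w_1,\dots,1/w_n\}\frac{\alpha^N}{1-\alpha}$$ for each $N\geqslant 1$.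
   Context: A subspace means a linear subset. A subspace $M$ of $X$ is complemented in $X$ if there is a subspace $N$ (a complement) such that $X$ is the topological direct sum of $M$ and $N$; equivalently, there is a continuous linear projection of $X$ onto $M$. The sum is $X_1+\dots+X_n=\{x_1+\dots+x_n\mid x_i\in X_i\}$. For $u,v\in\mathbb{R}^n$, $u\leqslant v$ means coordinatewise inequality; $t$ denotes transpose; $I$ is the identity operator on $X$. Either hypothesis, in (1) or in (2), forces the spectral radius $r(E)\leqslant\alpha<1$; when $r(E)<1$, the subspace $\ker(P_1)\cap\dots\cap\ker(P_n)$ is a complement of $X_1+\dots+X_n$ in $X$, so that the continuous projection $P$ is well defined. *)

theory Defs
  imports "HOL-Analysis.Analysis"
begin

text \<open>
  A type of class \<^class>\<open>real_normed_field\<close> is, up to isometric isomorphism, the field of real or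
  of complex numbers (Ostrowski), so the scalar field \<open>'k\<close> below covers exactly the real and the
  complex case. The axiom on \<^const>\<open>of_real\<close> says that the scalar multiplication extends the real
  one that comes with the type class of the space.
\<close>

locale normed_space_over = vector_space smul
  for smul :: "'k::real_normed_field \<Rightarrow> 'a::real_normed_vector \<Rightarrow> 'a" +
  assumes scale_of_real: "smul (of_real r) x = r *\<^sub>R x"
    and norm_scale: "norm (smul c x) = norm c * norm x"

definition topological_direct_sum ::
  "('k::real_normed_field \<Rightarrow> 'a::real_normed_vector \<Rightarrow> 'a) \<Rightarrow> 'a set \<Rightarrow> 'a set \<Rightarrow> bool" where
  "topological_direct_sum smul M N \<longleftrightarrow>
     module.subspace smul M \<and> module.subspace smul N \<and>
     (\<exists>g. homeomorphism (M \<times> N) UNIV (\<lambda>(x, y). x + y) g)"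

definition complemented ::
  "('k::real_normed_field \<Rightarrow> 'a::real_normed_vector \<Rightarrow> 'a) \<Rightarrow> 'a set \<Rightarrow> bool" where
  "complemented smul M \<longleftrightarrow> (\<exists>N. topological_direct_sum smul M N)"

definition continuous_projection_onto ::
  "('k::real_normed_field \<Rightarrow> 'a::real_normed_vector \<Rightarrow> 'a) \<Rightarrow> 'a set \<Rightarrow> ('a \<Rightarrow> 'a) \<Rightarrow> bool" where
  "continuous_projection_onto smul M P \<longleftrightarrow>
     Vector_Spaces.linear smul smul P \<and> bounded_linear P \<and> P \<circ> P = P \<and> range P = M"

definition kernel :: "('a \<Rightarrow> 'b::zero) \<Rightarrow> 'a set" where
  "kernel f = {x. f x = 0}"

definition subspace_sum :: "('n::finite \<Rightarrow> 'a::comm_monoid_add set) \<Rightarrow> 'a set" where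
  "subspace_sum X = {\<Sum>i\<in>UNIV. x i | x. \<forall>i. x i \<in> X i}"

text \<open>
  The projection onto \<open>M\<close> along \<open>N\<close>; meaningful only if the space is the direct sum of \<open>M\<close> and
  \<open>N\<close>.
\<close>

definition projection_along :: "'a::ab_group_add set \<Rightarrow> 'a set \<Rightarrow> 'a \<Rightarrow> 'a" where
  "projection_along M N x = (THE m. m \<in> M \<and> x - m \<in> N)"

lemma (in normed_space_over) projection_along_eqI:
  assumes "topological_direct_sum smul M N" "m \<in> M" "x - m \<in> N"
  shows "projection_along M N x = m"
proof -
  obtain g where g: "homeomorphism (M \<times> N) UNIV (\<lambda>(x, y). x + y) g"
    using assms(1) unfolding topological_direct_sum_def by blast
  have uniq: "m' = m" if "m' \<in> M" "x - m' \<in> N" for m'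
  proof -
    have "g (m' + (x - m')) = (m', x - m')" "g (m + (x - m)) = (m, x - m)"
      using homeomorphism_apply1[OF g, of "(m', x - m')"] homeomorphism_apply1[OF g, of "(m, x - m)"]
        that assms(2,3) by auto
    then show ?thesis by simp
  qed
  show ?thesis
    unfolding projection_along_def by (rule the_equality) (blast intro: assms(2,3) uniq)+
qed

lemma (in normed_space_over) continuous_linear_imp_bounded_linear:
  assumes lin: "Vector_Spaces.linear smul smul P" and cont: "continuous_on UNIV P"
  shows "bounded_linear P"
proof -
  interpret P: Vector_Spaces.linear smul smul P by (rule lin)
  have sc: "P (r *\<^sub>R x) = r *\<^sub>R P x" for r x
    using P.scale[of "of_real r" x] by (simp add: scale_of_real)
  have "isCont P 0" using cont by (simp add: continuous_on_eq_continuous_at)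
  then obtain d where d: "d > 0" "\<And>x. norm x < d \<Longrightarrow> norm (P x) < 1"
    unfolding continuous_at_eps_delta by (auto simp: dist_norm P.zero dest: spec[of _ 1])
  have bound: "norm (P x) \<le> norm x * (2 / d)" for x
  proof (cases "x = 0")
    case True then show ?thesis by (simp add: P.zero)
  next
    case False
    let ?r = "d / (2 * norm x)"
    have "norm (?r *\<^sub>R x) < d" using False d(1) by simp
    then have "norm (?r *\<^sub>R P x) < 1" using d(2) by (metis sc)
    then show ?thesis using False d(1) by (simp add: field_simps)
  qed
  show ?thesis
    by (rule bounded_linear_intro[where K = "2 / d"]) (use P.add sc bound in auto)
qed

lemma (in normed_space_over) projection_along:
  assumes tds: "topological_direct_sum smul M N"
  shows "continuous_projection_onto smul M (projection_along M N)"
    and "kernel (projection_along M N) = N"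
proof -
  let ?P = "projection_along M N"
  have M: "subspace M" and N: "subspace N"
    using tds unfolding topological_direct_sum_def by blast+
  obtain g where g: "homeomorphism (M \<times> N) UNIV (\<lambda>(x, y). x + y) g"
    using tds unfolding topological_direct_sum_def by blast
  have gMN: "g x \<in> M \<times> N" for x using homeomorphism_image2[OF g] by blast
  have gx: "fst (g x) + snd (g x) = x" for x
    using homeomorphism_apply2[OF g, of x] by (simp add: case_prod_beta)
  have P: "?P x \<in> M" "x - ?P x \<in> N" "?P x = fst (g x)" for x
  proof -
    have "x - fst (g x) = snd (g x)" using gx[of x] by (metis add_diff_cancel_left')
    then have 1: "fst (g x) \<in> M" "x - fst (g x) \<in> N"
      using gMN[of x] by (simp_all add: mem_Times_iff)
    have 2: "?P x = fst (g x)" by (rule projection_along_eqI[OF tds 1])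
    show "?P x \<in> M" "x - ?P x \<in> N" "?P x = fst (g x)" using 1 2 by auto
  qed
  have eq: "?P = (\<lambda>x. fst (g x))" by (rule ext) (rule P(3))
  have add: "?P (x + y) = ?P x + ?P y" for x y
  proof (rule projection_along_eqI[OF tds])
    show "?P x + ?P y \<in> M" by (rule subspace_add[OF M P(1) P(1)])
    have "(x - ?P x) + (y - ?P y) \<in> N" by (rule subspace_add[OF N P(2) P(2)])
    then show "x + y - (?P x + ?P y) \<in> N" by (simp add: algebra_simps)
  qed
  have sc: "?P (smul c x) = smul c (?P x)" for c x
  proof (rule projection_along_eqI[OF tds])
    show "smul c (?P x) \<in> M" by (rule subspace_scale[OF M P(1)])
    have "smul c (x - ?P x) \<in> N" by (rule subspace_scale[OF N P(2)])
    then show "smul c x - smul c (?P x) \<in> N" by (simp add: scale_right_diff_distrib)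
  qed
  have lin: "Vector_Spaces.linear smul smul ?P"
    by unfold_locales (auto simp: add sc)
  have "continuous_on UNIV ?P"
    unfolding eq using homeomorphism_cont2[OF g] by (rule continuous_on_fst)
  then have bl: "bounded_linear ?P" by (rule continuous_linear_imp_bounded_linear[OF lin])
  have id: "?P x = x" if "x \<in> M" for x
    by (rule projection_along_eqI[OF tds]) (simp_all add: that subspace_0[OF N])
  have "?P \<circ> ?P = ?P" using id[OF P(1)] by (simp add: fun_eq_iff)
  moreover have "range ?P = M"
  proof
    show "range ?P \<subseteq> M" using P(1) by blast
    show "M \<subseteq> range ?P" using id by (metis rangeI subsetI)
  qed
  ultimately show "continuous_projection_onto smul M ?P"
    unfolding continuous_projection_onto_def using lin bl by auto
  show "kernel ?P = N"
  proof -
    have "?P x = 0 \<Longrightarrow> x \<in> N" for x using P(2)[of x] by simp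
    moreover have "?P x = 0" if "x \<in> N" for x
      by (rule projection_along_eqI[OF tds]) (simp_all add: that subspace_0[OF M])
    ultimately show ?thesis unfolding kernel_def by auto
  qed
qed

end

theory Submission
  imports Defs
begin

text \<open>
  Why the theorem holds. The operator \<open>I - A\<close> leaves \<open>X\<^sub>1 + \<dots> + X\<^sub>n\<close> invariant, and it lifts to
  tuples: \<open>I - A\<close> sends \<open>\<Sum>\<^sub>i x\<^sub>i\<close> to the sum of the tuple with entries \<open>x\<^sub>i - P\<^sub>i (\<Sum>\<^sub>j x\<^sub>j)\<close>. If
  \<open>x\<^sub>i \<in> X\<^sub>i\<close> for all \<open>i\<close>, then \<open>P\<^sub>i x\<^sub>i = x\<^sub>i\<close>, so only the off-diagonal terms \<open>- P\<^sub>i x\<^sub>j\<close> survive and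
  the vector of norms of the new tuple is at most \<open>E\<close> times the vector of norms of the old one
  (\<open>norm_residual_le\<close>). Either hypothesis on \<open>E\<close> therefore provides a measure of size of tuples that
  the lifted map shrinks by the factor \<open>\<alpha>\<close>: under \<open>E w \<le> \<alpha> w\<close> it is the weighted maximum norm
  \<open>max\<^sub>i \<parallel>x\<^sub>i\<parallel> / w\<^sub>i\<close>, under \<open>E\<^sup>t w \<le> \<alpha> w\<close> the weighted sum norm \<open>\<Sum>\<^sub>i w\<^sub>i \<parallel>x\<^sub>i\<parallel>\<close>
  (\<open>Max_weighted_contraction\<close>, \<open>sum_weighted_contraction\<close>).

  Everything else is common to the two cases. Telescoping gives
  \<open>I - (I - A)\<^sup>N = \<Sum>\<^sub>k\<^sub><\<^sub>N (I - A)\<^sup>k A\<close>, and \<open>A x\<close> is the sum of the tuple \<open>(P\<^sub>i x)\<^sub>i\<close>, so the summands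
  decay geometrically. The limit \<open>Q x = \<Sum>\<^sub>k (I - A)\<^sup>k A x\<close> lies in \<open>X\<^sub>1 + \<dots> + X\<^sub>n\<close>, while \<open>x - Q x\<close>
  is killed by every \<open>P\<^sub>i\<close>, again by telescoping on tuples (\<open>P_Q\<close>). The sum of the two
  subspaces is direct, because a tuple in \<open>X\<^sub>1 \<times> \<dots> \<times> X\<^sub>n\<close> whose sum is killed by all \<open>P\<^sub>i\<close> is a fixed point of a
  contraction (\<open>subspace_sum_inter_kernels\<close>). Hence \<open>Q\<close> is the projection in
  question, and \<open>I - (I - A)\<^sup>N - Q\<close> is minus the tail of a geometrically dominated series, which is
  the claimed estimate (\<open>norm_error_le\<close>).
\<close>

section \<open>The lift of I - A to tuples\<close>

lemma mem_range_projection_iff: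
  assumes "continuous_projection_onto smul M P"
  shows "x \<in> M \<longleftrightarrow> P x = x"
proof -
  have "P \<circ> P = P" "range P = M"
    using assms unfolding continuous_projection_onto_def by auto
  then show ?thesis by (metis comp_apply rangeE rangeI)
qed

definition residual :: "('n::finite \<Rightarrow> 'a \<Rightarrow> 'a) \<Rightarrow> ('n \<Rightarrow> 'a) \<Rightarrow> 'n \<Rightarrow> 'a::real_normed_vector" where
  "residual P x = (\<lambda>i. x i - P i (\<Sum>j\<in>UNIV. x j))"

text \<open>
  Summation intertwines the lift with \<open>I - A\<close>, so the powers of \<open>I - A\<close> can be estimated on tuples,
  where the individual \<open>X\<^sub>i\<close> remain visible.
\<close>

lemma sum_residual_power:
  "(\<Sum>i\<in>UNIV. (residual P ^^ k) x i) = ((\<lambda>y. y - (\<Sum>i\<in>UNIV. P i y)) ^^ k) (\<Sum>i\<in>UNIV. x i)"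
proof (induction k)
  case (Suc k)
  have "(\<Sum>i\<in>UNIV. residual P y i) = (\<Sum>i\<in>UNIV. y i) - (\<Sum>i\<in>UNIV. P i (\<Sum>i\<in>UNIV. y i))" for y
    by (simp add: residual_def sum_subtractf)
  then show ?case by (simp add: Suc)
qed simp

text \<open>
  On tuples from \<open>X\<^sub>1 \<times> \<dots> \<times> X\<^sub>n\<close> the diagonal terms cancel, so that the matrix \<open>E\<close>, with its zero
  diagonal, dominates the lift.
\<close>

lemma norm_residual_le:
  assumes lin: "bounded_linear (P i)" and fixed: "P i (x i) = x i"
    and bound: "\<And>j. j \<noteq> i \<Longrightarrow> norm (P i (x j)) \<le> \<epsilon> i j * norm (x j)"
  shows "norm (residual P x i) \<le> (\<Sum>j\<in>UNIV. (if i = j then 0 else \<epsilon> i j) * norm (x j))"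
proof -
  have "P i (\<Sum>j\<in>UNIV. x j) = (\<Sum>j\<in>UNIV. P i (x j))"
    by (rule linear_sum[OF bounded_linear.linear[OF lin]])
  also have "\<dots> = x i + (\<Sum>j\<in>UNIV - {i}. P i (x j))"
    by (simp add: sum.remove[of UNIV i] fixed)
  finally have "norm (residual P x i) = norm (\<Sum>j\<in>UNIV - {i}. P i (x j))"
    by (simp add: residual_def)
  also have "\<dots> \<le> (\<Sum>j\<in>UNIV - {i}. \<epsilon> i j * norm (x j))"
    by (rule sum_norm_le) (simp add: bound)
  also have "\<dots> = (\<Sum>j\<in>UNIV. (if i = j then 0 else \<epsilon> i j) * norm (x j))"
    by (simp add: sum.remove[of UNIV i] cong: if_cong)
  finally show ?thesis .
qed

section \<open>Projections with a contracting lift\<close>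

text \<open>
  The part of the argument that does not see which hypothesis on \<open>E\<close> is in force: it only uses a
  measure \<open>s\<close> of the size of tuples that the lift shrinks by the factor \<open>\<alpha>\<close>. The two constants
  compare \<open>s\<close> with the norm of the space, \<open>b\<close> on the starting tuples \<open>(P\<^sub>i x)\<^sub>i\<close> and \<open>c\<close> on sums.
\<close>

locale contracting_projections = normed_space_over smul
  for smul :: "'k::real_normed_field \<Rightarrow> 'a::banach \<Rightarrow> 'a" +
  fixes X :: "'n::finite \<Rightarrow> 'a set" and P :: "'n \<Rightarrow> 'a \<Rightarrow> 'a"
    and s :: "('n \<Rightarrow> 'a) \<Rightarrow> real" and \<alpha> b c :: real
  assumes proj: "continuous_projection_onto smul (X i) (P i)"
    and alpha: "0 \<le> \<alpha>" "\<alpha> < 1" and b: "0 \<le> b" and c: "0 \<le> c"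
    and sum_norm_le_size: "(\<And>i. x i \<in> X i) \<Longrightarrow> (\<Sum>i\<in>UNIV. norm (x i)) \<le> c * s x"
    and size_residual: "(\<And>i. x i \<in> X i) \<Longrightarrow> s (residual P x) \<le> \<alpha> * s x"
    and size_start: "s (\<lambda>i. P i y) \<le> b * norm y"
begin

abbreviation T :: "'a \<Rightarrow> 'a" where
  "T \<equiv> \<lambda>y. y - (\<Sum>i\<in>UNIV. P i y)"

abbreviation iterate :: "nat \<Rightarrow> 'a \<Rightarrow> 'n \<Rightarrow> 'a" where
  "iterate k x \<equiv> (residual P ^^ k) (\<lambda>i. P i x)"

text \<open>The series \<open>\<Sum>\<^sub>k (I - A)\<^sup>k A x\<close>, each term split along the \<open>X\<^sub>i\<close>.\<close>

definition Q :: "'a \<Rightarrow> 'a" where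
  "Q x = (\<Sum>k. \<Sum>i\<in>UNIV. iterate k x i)"

lemma bounded_linear_P: "bounded_linear (P i)"
  and linear_P: "Vector_Spaces.linear smul smul (P i)"
  and P_in: "P i x \<in> X i"
  using proj[of i] unfolding continuous_projection_onto_def by auto

lemma in_X_iff: "x \<in> X i \<longleftrightarrow> P i x = x"
  by (rule mem_range_projection_iff[OF proj])

lemma P_add: "P i (x + y) = P i x + P i y"
  and P_diff: "P i (x - y) = P i x - P i y"
  and P_zero: "P i 0 = 0"
  using linear_simps[OF bounded_linear_P] by auto

lemma P_smul: "P i (smul a x) = smul a (P i x)"
  using linear_P[of i] unfolding Vector_Spaces.linear_def module_hom_def module_hom_axioms_def by auto

lemma P_residual: "(\<And>i. x i \<in> X i) \<Longrightarrow> residual P x i \<in> X i"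
  using P_in[of i] by (simp add: residual_def in_X_iff P_diff)

lemma residual_power_in: "(\<And>i. x i \<in> X i) \<Longrightarrow> (residual P ^^ k) x i \<in> X i"
  by (induction k arbitrary: i) (simp_all add: P_residual)

lemma size_residual_power:
  assumes "\<And>i. x i \<in> X i"
  shows "s ((residual P ^^ k) x) \<le> \<alpha> ^ k * s x"
proof (induction k)
  case (Suc k)
  have "s ((residual P ^^ Suc k) x) \<le> \<alpha> * s ((residual P ^^ k) x)"
    using size_residual[OF residual_power_in[OF assms]] by simp
  also have "\<dots> \<le> \<alpha> * (\<alpha> ^ k * s x)"
    using Suc alpha(1) by (rule mult_left_mono)
  finally show ?case by simp
qed simp

lemma sum_norm_residual_power_le:
  assumes "\<And>i. x i \<in> X i"
  shows "(\<Sum>i\<in>UNIV. norm ((residual P ^^ k) x i)) \<le> c * s x * \<alpha> ^ k"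
proof -
  have "(\<Sum>i\<in>UNIV. norm ((residual P ^^ k) x i)) \<le> c * s ((residual P ^^ k) x)"
    by (rule sum_norm_le_size) (rule residual_power_in[OF assms])
  also have "\<dots> \<le> c * (\<alpha> ^ k * s x)"
    using size_residual_power[OF assms] c by (rule mult_left_mono)
  finally show ?thesis by (simp add: ac_simps)
qed

lemma sum_norm_iterate_le: "(\<Sum>i\<in>UNIV. norm (iterate k x i)) \<le> c * b * norm x * \<alpha> ^ k"
proof -
  have "(\<Sum>i\<in>UNIV. norm (iterate k x i)) \<le> c * s (\<lambda>i. P i x) * \<alpha> ^ k"
    by (rule sum_norm_residual_power_le) (rule P_in)
  also have "\<dots> \<le> c * (b * norm x) * \<alpha> ^ k"
    by (intro mult_right_mono mult_left_mono size_start) (use c alpha in auto)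
  finally show ?thesis by (simp add: ac_simps)
qed

lemma norm_iterate_le: "norm (iterate k x i) \<le> c * b * norm x * \<alpha> ^ k"
  using member_le_sum[of i UNIV "\<lambda>i. norm (iterate k x i)"] sum_norm_iterate_le[of k x] by simp

lemma summable_geometric_bound: "summable (\<lambda>k. d * \<alpha> ^ k)"
  using alpha by (intro summable_mult summable_geometric) simp

lemma iterate_summable: "summable (\<lambda>k. iterate k x i)"
  by (rule summable_comparison_test'[OF summable_geometric_bound norm_iterate_le])

lemma iterate_tendsto_0: "(\<lambda>k. iterate k x i) \<longlonglongrightarrow> 0"
  by (rule summable_LIMSEQ_zero[OF iterate_summable])

section \<open>The limit is the projection\<close>

lemma sum_iterate_sums: "(\<lambda>k. \<Sum>i\<in>UNIV. iterate k x i) sums Q x"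
  unfolding Q_def by (intro summable_sums summable_sum iterate_summable)

text \<open>Summing first over \<open>k\<close> decomposes \<open>Q x\<close> along the \<open>X\<^sub>i\<close>, which are closed.\<close>

lemma Q_in_subspace_sum: "Q x \<in> subspace_sum X"
proof -
  define y where "y i = (\<Sum>k. iterate k x i)" for i
  have "P i (y i) = y i" for i
  proof -
    have "P i (iterate k x i) = iterate k x i" for k
      using residual_power_in[of "\<lambda>i. P i x" k i] P_in by (simp add: in_X_iff)
    then show ?thesis
      unfolding y_def
      using bounded_linear.suminf[OF bounded_linear_P iterate_summable, of i x i] by simp
  qed
  moreover have "Q x = (\<Sum>i\<in>UNIV. y i)"
    unfolding Q_def y_def by (rule suminf_sum) (rule iterate_summable)
  ultimately show ?thesis
    unfolding subspace_sum_def by (auto simp: in_X_iff)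
qed

text \<open>
  By definition of the lift, \<open>P\<^sub>i\<close> applied to the sum of a tuple is the difference of the \<open>i\<close>-th
  entries of the tuple and of its image; so \<open>P\<^sub>i (Q x)\<close> telescopes to the first entry \<open>P\<^sub>i x\<close>.
\<close>

lemma P_Q: "P i (Q x) = P i x"
proof -
  have "(\<lambda>k. P i (\<Sum>j\<in>UNIV. iterate k x j)) sums P i (Q x)"
    by (rule bounded_linear.sums[OF bounded_linear_P sum_iterate_sums])
  moreover have "P i (\<Sum>j\<in>UNIV. iterate k x j) = iterate k x i - iterate (Suc k) x i" for k
    by (simp add: residual_def)
  moreover have "(\<lambda>k. iterate k x i - iterate (Suc k) x i) sums (iterate 0 x i - 0)"
    by (rule telescope_sums'[OF iterate_tendsto_0])
  ultimately show ?thesis by (simp add: sums_unique2)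
qed

lemma diff_Q_in_kernels: "x - Q x \<in> (\<Inter>i. kernel (P i))"
  by (simp add: kernel_def P_diff P_Q)

lemma subspace_sum_inter_kernels:
  assumes "y \<in> subspace_sum X" "y \<in> (\<Inter>i. kernel (P i))"
  shows "y = 0"
proof -
  obtain x where x: "\<And>i. x i \<in> X i" "y = (\<Sum>i\<in>UNIV. x i)"
    using assms(1) unfolding subspace_sum_def by blast
  have "residual P x = x"
    using assms(2) by (simp add: residual_def kernel_def x(2))
  then have pow: "(residual P ^^ k) x = x" for k by (induction k) simp_all
  \<comment> \<open>iterating does not change \<open>x\<close>, so its norms lie below every term of a null sequence\<close>
  have le: "(\<Sum>i\<in>UNIV. norm (x i)) \<le> c * s x * \<alpha> ^ k" for k
    using sum_norm_residual_power_le[OF x(1), where k = k] by (simp add: pow)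
  have "(\<lambda>k. c * s x * \<alpha> ^ k) \<longlonglongrightarrow> 0"
    by (rule summable_LIMSEQ_zero[OF summable_geometric_bound])
  then have "(\<Sum>i\<in>UNIV. norm (x i)) \<le> 0"
    by (rule LIMSEQ_le_const) (use le in blast)
  then have "norm y \<le> 0"
    unfolding x(2) by (rule order_trans[OF norm_sum])
  then show ?thesis by simp
qed

lemma subspace_X: "subspace (X i)"
  by (rule subspaceI) (simp_all add: in_X_iff P_zero P_add P_smul)

lemma subspace_subspace_sum: "subspace (subspace_sum X)"
proof (rule subspaceI)
  show "0 \<in> subspace_sum X"
    unfolding subspace_sum_def using subspace_0[OF subspace_X]
    by (auto intro!: exI[of _ "\<lambda>_. 0"])
next
  fix x y assume "x \<in> subspace_sum X" "y \<in> subspace_sum X"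
  then obtain u v where "\<And>i. u i \<in> X i" "x = (\<Sum>i\<in>UNIV. u i)" "\<And>i. v i \<in> X i" "y = (\<Sum>i\<in>UNIV. v i)"
    unfolding subspace_sum_def by blast
  then show "x + y \<in> subspace_sum X"
    unfolding subspace_sum_def using subspace_add[OF subspace_X]
    by (auto simp: sum.distrib intro!: exI[of _ "\<lambda>i. u i + v i"])
next
  fix a x assume "x \<in> subspace_sum X"
  then obtain u where "\<And>i. u i \<in> X i" "x = (\<Sum>i\<in>UNIV. u i)"
    unfolding subspace_sum_def by blast
  then show "smul a x \<in> subspace_sum X"
    unfolding subspace_sum_def using subspace_scale[OF subspace_X]
    by (auto simp: scale_sum_right intro!: exI[of _ "\<lambda>i. smul a (u i)"])
qed

lemma subspace_kernels: "subspace (\<Inter>i. kernel (P i))"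
  by (rule subspaceI) (simp_all add: kernel_def P_zero P_add P_smul)

text \<open>
  Two such decompositions of \<open>x\<close> differ by a vector in both subspaces, which vanishes. This
  identifies the limit \<open>Q\<close> with the projection and makes it subtractive without a look at the series.
\<close>

lemma Q_unique:
  assumes "m \<in> subspace_sum X" "x - m \<in> (\<Inter>i. kernel (P i))"
  shows "Q x = m"
proof -
  have "Q x - m \<in> subspace_sum X"
    by (rule subspace_diff[OF subspace_subspace_sum Q_in_subspace_sum assms(1)])
  moreover have "(x - m) - (x - Q x) \<in> (\<Inter>i. kernel (P i))"
    by (rule subspace_diff[OF subspace_kernels assms(2) diff_Q_in_kernels])
  ultimately show ?thesis
    using subspace_sum_inter_kernels[of "Q x - m"] by simp
qed

lemma Q_diff: "Q (x - y) = Q x - Q y"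
proof (rule Q_unique)
  show "Q x - Q y \<in> subspace_sum X"
    by (rule subspace_diff[OF subspace_subspace_sum]) (rule Q_in_subspace_sum)+
  have "(x - Q x) - (y - Q y) \<in> (\<Inter>i. kernel (P i))"
    by (rule subspace_diff[OF subspace_kernels]) (rule diff_Q_in_kernels)+
  then show "x - y - (Q x - Q y) \<in> (\<Inter>i. kernel (P i))"
    by (simp add: algebra_simps)
qed

section \<open>The error estimate and the topological direct sum\<close>

text \<open>The error is minus the tail of the series for \<open>Q x\<close>.\<close>

lemma norm_error_le: "norm (x - (T ^^ N) x - Q x) \<le> c * b * (\<alpha> ^ N / (1 - \<alpha>)) * norm x"
proof -
  let ?f = "\<lambda>k. \<Sum>i\<in>UNIV. iterate k x i"
  have f: "?f k = (T ^^ k) x - (T ^^ Suc k) x" for k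
  proof -
    have "?f k = (T ^^ k) (x - T x)" by (simp add: sum_residual_power)
    also have "\<dots> = (T ^^ k) x - (T ^^ k) (T x)"
    proof (induction k)
      case (Suc k)
      then show ?case by (simp add: P_diff sum_subtractf)
    qed simp
    also have "(T ^^ k) (T x) = (T ^^ Suc k) x" by (simp only: funpow_Suc_right o_apply)
    finally show ?thesis .
  qed
  have "(\<Sum>k<N. ?f k) = x - (T ^^ N) x"
    unfolding f using sum_lessThan_telescope'[of "\<lambda>k. (T ^^ k) x" N] by simp
  then have tail: "(\<lambda>k. ?f (k + N)) sums (Q x - (x - (T ^^ N) x))"
    using sums_split_initial_segment[OF sum_iterate_sums[of x], of N] by simp
  have bound: "norm (?f (k + N)) \<le> c * b * norm x * \<alpha> ^ N * \<alpha> ^ k" for k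
    using order_trans[OF norm_sum sum_norm_iterate_le[of "k + N" x]]
    by (simp add: power_add ac_simps)
  have "(\<lambda>k. c * b * norm x * \<alpha> ^ N * \<alpha> ^ k) sums (c * b * norm x * \<alpha> ^ N * (1 / (1 - \<alpha>)))"
    using alpha by (intro sums_mult geometric_sums) simp
  then have "norm (Q x - (x - (T ^^ N) x)) \<le> c * b * norm x * \<alpha> ^ N * (1 / (1 - \<alpha>))"
    by (rule norm_sums_le[OF tail]) (rule bound)
  then show ?thesis by (simp add: norm_minus_commute algebra_simps)
qed

text \<open>\<open>Q\<close> is subtractive, so a bound on its norm makes it Lipschitz.\<close>

lemma continuous_Q: "continuous_on UNIV Q"
proof (rule continuous_on_subset[OF lipschitz_on_continuous_on])
  \<comment> \<open>for \<open>N = 0\<close> the error is \<open>- Q x\<close>\<close>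
  have "norm (Q x) \<le> c * b * (1 / (1 - \<alpha>)) * norm x" for x
    using norm_error_le[of x 0] by simp
  then show "(c * b * (1 / (1 - \<alpha>)))-lipschitz_on UNIV Q"
    using alpha b c by (intro lipschitz_onI) (simp_all add: dist_norm flip: Q_diff)
qed simp

lemma topological_direct_sum_kernels:
  "topological_direct_sum smul (subspace_sum X) (\<Inter>i. kernel (P i))"
  unfolding topological_direct_sum_def
proof (intro conjI exI)
  show "subspace (subspace_sum X)" by (rule subspace_subspace_sum)
  show "subspace (\<Inter>i. kernel (P i))" by (rule subspace_kernels)
  show "homeomorphism (subspace_sum X \<times> (\<Inter>i. kernel (P i))) UNIV (\<lambda>(x, y). x + y)
    (\<lambda>x. (Q x, x - Q x))"
  proof (rule homeomorphismI)
    show "continuous_on (subspace_sum X \<times> (\<Inter>i. kernel (P i))) (\<lambda>(x, y). x + y)"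
      by (simp add: case_prod_beta continuous_intros)
    show "continuous_on UNIV (\<lambda>x. (Q x, x - Q x))"
      by (intro continuous_intros continuous_Q)
    show "(\<lambda>x. (Q x, x - Q x)) ` UNIV \<subseteq> subspace_sum X \<times> (\<Inter>i. kernel (P i))"
      using Q_in_subspace_sum diff_Q_in_kernels by blast
    fix z assume z: "z \<in> subspace_sum X \<times> (\<Inter>i. kernel (P i))"
    then have "Q (fst z + snd z) = fst z"
      by (intro Q_unique) (auto simp: mem_Times_iff)
    then show "(Q (case z of (x, y) \<Rightarrow> x + y), (case z of (x, y) \<Rightarrow> x + y) - Q (case z of (x, y) \<Rightarrow> x + y)) = z"
      by (simp add: case_prod_beta)
  qed simp_all
qed

lemma onorm_error_le:
  "onorm (\<lambda>x. x - (T ^^ N) x - projection_along (subspace_sum X) (\<Inter>i. kernel (P i)) x)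
    \<le> c * b * (\<alpha> ^ N / (1 - \<alpha>))"
proof (rule onorm_bound)
  have "projection_along (subspace_sum X) (\<Inter>i. kernel (P i)) x = Q x" for x
    by (rule projection_along_eqI[OF topological_direct_sum_kernels Q_in_subspace_sum diff_Q_in_kernels])
  then show "norm (x - (T ^^ N) x - projection_along (subspace_sum X) (\<Inter>i. kernel (P i)) x)
    \<le> c * b * (\<alpha> ^ N / (1 - \<alpha>)) * norm x" for x
    using norm_error_le by simp
  show "0 \<le> c * b * (\<alpha> ^ N / (1 - \<alpha>))" using alpha b c by simp
qed

end

section \<open>The two weighted norms\<close>

text \<open>
  If \<open>u\<close> is the vector of norms of a tuple and \<open>m\<close> its weighted maximum norm, then \<open>u \<le> m w\<close>, hence
  \<open>E u \<le> m E w \<le> \<alpha> m w\<close>.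
\<close>

lemma Max_weighted_contraction:
  fixes E :: "real ^ 'n ^ 'n" and w :: "real ^ 'n" and u v :: "'n \<Rightarrow> real"
  assumes w: "\<And>i. 0 < w $ i" and E: "\<And>i j. 0 \<le> E $ i $ j"
    and Ew: "E *v w \<le> \<alpha> *\<^sub>R w" and u: "\<And>i. 0 \<le> u i" and v: "\<And>i. v i \<le> (\<Sum>j\<in>UNIV. E $ i $ j * u j)"
  shows "(MAX i. v i / w $ i) \<le> \<alpha> * (MAX i. u i / w $ i)"
proof -
  let ?m = "MAX i. u i / w $ i"
  have le: "u j / w $ j \<le> ?m" for j by (rule Max_ge) auto
  have m: "0 \<le> ?m" using order_trans[OF _ le] w u by (meson divide_nonneg_pos)
  have um: "u j \<le> ?m * w $ j" for j using le[of j] w[of j] by (metis pos_divide_le_eq)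
  have "v i / w $ i \<le> \<alpha> * ?m" for i
  proof -
    have "v i \<le> (\<Sum>j\<in>UNIV. E $ i $ j * (?m * w $ j))"
      using v[of i] by (rule order_trans) (intro sum_mono mult_left_mono um E)
    also have "\<dots> = ?m * (E *v w) $ i"
      by (simp add: matrix_vector_mult_def sum_distrib_left ac_simps)
    also have "\<dots> \<le> ?m * (\<alpha> * w $ i)"
      using Ew m by (intro mult_left_mono) (simp_all add: less_eq_vec_def)
    finally show ?thesis using w[of i] by (simp add: pos_divide_le_eq ac_simps)
  qed
  then show ?thesis by (intro Max.boundedI) auto
qed

text \<open>By duality, \<open>w \<bullet> E u = E\<^sup>t w \<bullet> u \<le> \<alpha> (w \<bullet> u)\<close> for a vector of norms \<open>u\<close>.\<close>

lemma sum_weighted_contraction: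
  fixes E :: "real ^ 'n ^ 'n" and w :: "real ^ 'n" and u v :: "'n \<Rightarrow> real"
  assumes w: "\<And>i. 0 < w $ i"
    and Ew: "transpose E *v w \<le> \<alpha> *\<^sub>R w" and u: "\<And>i. 0 \<le> u i"
    and v: "\<And>i. v i \<le> (\<Sum>j\<in>UNIV. E $ i $ j * u j)"
  shows "(\<Sum>i\<in>UNIV. w $ i * v i) \<le> \<alpha> * (\<Sum>i\<in>UNIV. w $ i * u i)"
proof -
  have "(\<Sum>i\<in>UNIV. w $ i * v i) \<le> (\<Sum>i\<in>UNIV. w $ i * (\<Sum>j\<in>UNIV. E $ i $ j * u j))"
    by (intro sum_mono mult_left_mono v) (simp add: w less_imp_le)
  also have "\<dots> = (\<Sum>j\<in>UNIV. (transpose E *v w) $ j * u j)"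
    unfolding sum_distrib_left
    by (subst sum.swap)
      (simp add: matrix_vector_mult_def transpose_def sum_distrib_left sum_distrib_right ac_simps)
  also have "\<dots> \<le> (\<Sum>j\<in>UNIV. \<alpha> * w $ j * u j)"
    using Ew by (intro sum_mono mult_right_mono u) (simp add: less_eq_vec_def)
  finally show ?thesis by (simp add: sum_distrib_left ac_simps)
qed

theorem theorem2p2:
  fixes smul :: "'k::real_normed_field \<Rightarrow> 'a::banach \<Rightarrow> 'a"
    and X :: "'n::finite \<Rightarrow> 'a set"
    and P :: "'n \<Rightarrow> 'a \<Rightarrow> 'a"
    and \<epsilon> :: "'n \<Rightarrow> 'n \<Rightarrow> real"
    and E :: "real ^ 'n ^ 'n"
    and A P0 :: "'a \<Rightarrow> 'a"
  assumes "normed_space_over smul"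
    and "\<And>i. complemented smul (X i)"
    and "\<And>i. continuous_projection_onto smul (X i) (P i)"
    and "\<And>i j. i \<noteq> j \<Longrightarrow> 0 \<le> \<epsilon> i j"
    and "\<And>i j x. i \<noteq> j \<Longrightarrow> x \<in> X j \<Longrightarrow> norm (P i x) \<le> \<epsilon> i j * norm x"
    and "E = (\<chi> i j. if i = j then 0 else \<epsilon> i j)"
    and "A = (\<lambda>x. \<Sum>i\<in>UNIV. P i x)"
    and "P0 = projection_along (subspace_sum X) (\<Inter>i. kernel (P i))"
  shows
    "(\<forall>(w :: real ^ 'n) \<alpha>. (\<forall>i. 0 < w $ i) \<and> 0 \<le> \<alpha> \<and> \<alpha> < 1 \<and> E *v w \<le> \<alpha> *\<^sub>R w \<longrightarrow>
        topological_direct_sum smul (subspace_sum X) (\<Inter>i. kernel (P i)) \<and>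
        (\<forall>N\<ge>1. onorm (\<lambda>x. x - ((\<lambda>y. y - A y) ^^ N) x - P0 x)
          \<le> (\<Sum>i\<in>UNIV. w $ i) * (MAX i. (1 / w $ i) * onorm (P i)) * (\<alpha> ^ N / (1 - \<alpha>))))
     \<and>
     (\<forall>(w :: real ^ 'n) \<alpha>. (\<forall>i. 0 < w $ i) \<and> 0 \<le> \<alpha> \<and> \<alpha> < 1 \<and> transpose E *v w \<le> \<alpha> *\<^sub>R w \<longrightarrow>
        topological_direct_sum smul (subspace_sum X) (\<Inter>i. kernel (P i)) \<and>
        (\<forall>N\<ge>1. onorm (\<lambda>x. x - ((\<lambda>y. y - A y) ^^ N) x - P0 x)
          \<le> (\<Sum>i\<in>UNIV. w $ i * onorm (P i)) * (MAX i. 1 / w $ i) * (\<alpha> ^ N / (1 - \<alpha>))))"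
proof (rule conjI; intro allI impI; elim conjE)
  have Pbl: "bounded_linear (P i)" for i
    using assms(3)[of i] unfolding continuous_projection_onto_def by blast
  have PX: "x \<in> X i \<Longrightarrow> P i x = x" for i x
    using mem_range_projection_iff[OF assms(3)] by blast
  have onormP: "norm (P i x) \<le> onorm (P i) * norm x" "0 \<le> onorm (P i)" for i x
    by (rule onorm[OF Pbl]) (rule onorm_pos_le[OF Pbl])
  have E: "0 \<le> E $ i $ j" for i j using assms(4) by (simp add: assms(6))
  have residual: "norm (residual P x i) \<le> (\<Sum>j\<in>UNIV. E $ i $ j * norm (x j))"
    if x: "\<And>i. x i \<in> X i" for x i
  proof -
    have "norm (residual P x i) \<le> (\<Sum>j\<in>UNIV. (if i = j then 0 else \<epsilon> i j) * norm (x j))"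
      by (rule norm_residual_le) (use x Pbl PX assms(5) in auto)
    then show ?thesis by (simp add: assms(6))
  qed
  {
    fix w :: "real ^ 'n" and \<alpha> :: real
    assume w: "\<forall>i. 0 < w $ i" and \<alpha>: "0 \<le> \<alpha>" "\<alpha> < 1" and Ew: "E *v w \<le> \<alpha> *\<^sub>R w"
    let ?b = "MAX i. (1 / w $ i) * onorm (P i)"
    have leb: "1 / w $ i * onorm (P i) \<le> ?b" for i by (rule Max_ge) auto
    interpret contracting_projections smul X P "\<lambda>x. MAX i. norm (x i) / w $ i" \<alpha> ?b "\<Sum>i\<in>UNIV. w $ i"
    proof (intro contracting_projections.intro contracting_projections_axioms.intro)
      show "0 \<le> ?b" using order_trans[OF _ leb] w onormP(2) by (meson divide_nonneg_pos mult_nonneg_nonneg zero_le_one)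
      show "0 \<le> (\<Sum>i\<in>UNIV. w $ i)" using w by (simp add: sum_nonneg less_imp_le)
      fix x :: "'n \<Rightarrow> 'a"
      have "norm (x i) \<le> w $ i * (MAX i. norm (x i) / w $ i)" for i
      proof -
        have "norm (x i) / w $ i \<le> (MAX i. norm (x i) / w $ i)" by (rule Max_ge) auto
        then show ?thesis using w by (metis pos_divide_le_eq mult.commute)
      qed
      then show "(\<Sum>i\<in>UNIV. norm (x i)) \<le> (\<Sum>i\<in>UNIV. w $ i) * (MAX i. norm (x i) / w $ i)"
        unfolding sum_distrib_right by (rule sum_mono)
      show "(MAX i. norm (residual P x i) / w $ i) \<le> \<alpha> * (MAX i. norm (x i) / w $ i)"
        if "\<And>i. x i \<in> X i"
        by (rule Max_weighted_contraction[OF _ E Ew _ residual[OF that]]) (use w in auto)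
    next
      fix x
      have "norm (P i x) / w $ i \<le> ?b * norm x" for i
      proof -
        have "norm (P i x) / w $ i \<le> onorm (P i) * norm x / w $ i"
          using w onormP(1) by (simp add: divide_right_mono less_imp_le)
        also have "\<dots> = 1 / w $ i * onorm (P i) * norm x" by simp
        also have "\<dots> \<le> ?b * norm x" by (rule mult_right_mono[OF leb]) simp
        finally show ?thesis .
      qed
      then show "(MAX i. norm (P i x) / w $ i) \<le> ?b * norm x" by (intro Max.boundedI) auto
    qed (use assms(1,3) \<alpha> in auto)
    show "topological_direct_sum smul (subspace_sum X) (\<Inter>i. kernel (P i)) \<and>
        (\<forall>N\<ge>1. onorm (\<lambda>x. x - ((\<lambda>y. y - A y) ^^ N) x - P0 x)
          \<le> (\<Sum>i\<in>UNIV. w $ i) * ?b * (\<alpha> ^ N / (1 - \<alpha>)))"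
      unfolding assms(7,8) using topological_direct_sum_kernels onorm_error_le by blast
  next
    fix w :: "real ^ 'n" and \<alpha> :: real
    assume w: "\<forall>i. 0 < w $ i" and \<alpha>: "0 \<le> \<alpha>" "\<alpha> < 1" and Ew: "transpose E *v w \<le> \<alpha> *\<^sub>R w"
    let ?b = "\<Sum>i\<in>UNIV. w $ i * onorm (P i)" and ?c = "MAX i. 1 / w $ i"
    have lec: "1 / w $ i \<le> ?c" for i by (rule Max_ge) auto
    interpret contracting_projections smul X P "\<lambda>x. \<Sum>i\<in>UNIV. w $ i * norm (x i)" \<alpha> ?b ?c
    proof (intro contracting_projections.intro contracting_projections_axioms.intro)
      show "0 \<le> ?b" using w onormP(2) by (simp add: sum_nonneg less_imp_le)
      show "0 \<le> ?c" using order_trans[OF _ lec] w by (meson divide_nonneg_pos zero_le_one)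
      fix x :: "'n \<Rightarrow> 'a"
      have "norm (x i) \<le> ?c * (w $ i * norm (x i))" for i
      proof -
        have "norm (x i) = 1 / w $ i * (w $ i * norm (x i))" using w by (simp add: less_imp_neq[symmetric])
        also have "\<dots> \<le> ?c * (w $ i * norm (x i))"
          by (rule mult_right_mono[OF lec]) (simp add: w less_imp_le)
        finally show ?thesis .
      qed
      then show "(\<Sum>i\<in>UNIV. norm (x i)) \<le> ?c * (\<Sum>i\<in>UNIV. w $ i * norm (x i))"
        unfolding sum_distrib_left by (rule sum_mono)
      show "(\<Sum>i\<in>UNIV. w $ i * norm (residual P x i)) \<le> \<alpha> * (\<Sum>i\<in>UNIV. w $ i * norm (x i))"
        if "\<And>i. x i \<in> X i"
        by (rule sum_weighted_contraction[OF _ Ew _ residual[OF that]]) (use w in auto)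
    next
      fix x
      show "(\<Sum>i\<in>UNIV. w $ i * norm (P i x)) \<le> ?b * norm x"
        unfolding sum_distrib_right mult.assoc
        by (intro sum_mono mult_left_mono onormP(1)) (simp add: w less_imp_le)
    qed (use assms(1,3) \<alpha> in auto)
    show "topological_direct_sum smul (subspace_sum X) (\<Inter>i. kernel (P i)) \<and>
        (\<forall>N\<ge>1. onorm (\<lambda>x. x - ((\<lambda>y. y - A y) ^^ N) x - P0 x)
          \<le> ?b * ?c * (\<alpha> ^ N / (1 - \<alpha>)))"
      unfolding assms(7,8)
      using topological_direct_sum_kernels onorm_error_le by (simp add: mult.commute[of ?b])
  }
qed

end
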